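(* Let $1\le p<\infty$ and let $T$ be an injective quasinilpotent forward unilateral weighted shift on $\ell^p(\mathbb{N})$. If $k_{e_0}=1$, then $\Lambda(T)=\{1\}$.
   Context: $\ell^p(\mathbb{N})$ is the complex Banach space of $p$-summable complex sequences indexed by $\mathbb{N}=\{0,1,2,\dots\}$, with canonical basis $\{e_n\}_{n=0}^\infty$. A forward unilateral weighted shift on $\ell^p(\mathbb{N})$ with weight sequence $\{w_n\}_{n=0}^\infty$ is a bounded linear operator $T$ with $Te_n=w_ne_{n+1}$ for all $n\ge 0$; it is injective if $w_n\neq 0$ for every $n$. A bounded operator $T$ on a complex Banach space $X$ is quasinilpotent if its spectrum is $\{0\}$. For quasinilpotent $T$ and $x\in X\setminus\{0\}$, $$k_x=k_{(T,x)}=\limsup_{z\to 0}\frac{\ln\|(z-T)^{-1}x\|}{\ln\|(z-T)^{-1}\|}$$ ($z\in\mathbb{C}\setminus\{0\}$), and the power set of $T$ is $\Lambda(T)=\{k_x: x\in X\setminus\{0\}\}$. *)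

theory Defs
  imports "HOL-Analysis.Analysis"
begin

text \<open>
  The exponent p is a real number and hence cannot be a parameter of a type. So the Banach space
  of p-summable complex sequences is a set of functions with an explicit norm, and an operator is a
  function on sequences of which only the values on that set are ever used.
\<close>

definition lp :: "real \<Rightarrow> (nat \<Rightarrow> complex) set" where
  "lp p = {x. summable (\<lambda>n. cmod (x n) powr p)}"

definition lp_norm :: "real \<Rightarrow> (nat \<Rightarrow> complex) \<Rightarrow> real" where
  "lp_norm p x = (\<Sum>n. cmod (x n) powr p) powr (1 / p)"

definition basis_seq :: "nat \<Rightarrow> nat \<Rightarrow> complex" where
  "basis_seq n = (\<lambda>k. if k = n then 1 else 0)"

type_synonym seq_op = "(nat \<Rightarrow> complex) \<Rightarrow> nat \<Rightarrow> complex"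

definition lp_bounded_operator :: "real \<Rightarrow> seq_op \<Rightarrow> bool" where
  "lp_bounded_operator p T \<longleftrightarrow>
     (\<forall>x\<in>lp p. T x \<in> lp p) \<and>
     (\<forall>x\<in>lp p. \<forall>y\<in>lp p. T (\<lambda>n. x n + y n) = (\<lambda>n. T x n + T y n)) \<and>
     (\<forall>c. \<forall>x\<in>lp p. T (\<lambda>n. c * x n) = (\<lambda>n. c * T x n)) \<and>
     (\<exists>C. \<forall>x\<in>lp p. lp_norm p (T x) \<le> C * lp_norm p x)"

text \<open>Meaningful for bounded operators only; otherwise the supremum is unspecified.\<close>

definition lp_opnorm :: "real \<Rightarrow> seq_op \<Rightarrow> real" where
  "lp_opnorm p T = (SUP x\<in>{x \<in> lp p. lp_norm p x \<le> 1}. lp_norm p (T x))"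

definition scalar_minus :: "complex \<Rightarrow> seq_op \<Rightarrow> seq_op" where
  "scalar_minus z T = (\<lambda>x n. z * x n - T x n)"

definition lp_invertible :: "real \<Rightarrow> seq_op \<Rightarrow> bool" where
  "lp_invertible p A \<longleftrightarrow>
     (\<exists>S. lp_bounded_operator p S \<and> (\<forall>x\<in>lp p. S (A x) = x \<and> A (S x) = x))"

definition lp_spectrum :: "real \<Rightarrow> seq_op \<Rightarrow> complex set" where
  "lp_spectrum p T = {z. \<not> lp_invertible p (scalar_minus z T)}"

definition quasinilpotent :: "real \<Rightarrow> seq_op \<Rightarrow> bool" where
  "quasinilpotent p T \<longleftrightarrow> lp_bounded_operator p T \<and> lp_spectrum p T = {0}"

definition lp_resolvent :: "real \<Rightarrow> seq_op \<Rightarrow> complex \<Rightarrow> seq_op" where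
  "lp_resolvent p T z = inv_into (lp p) (scalar_minus z T)"

text \<open>
  For quasinilpotent T and nonzero x, the norm of the resolvent at z is at least 1 / cmod z and the
  resolvent applied to x is nonzero, so for z near 0 the logarithms are of positive numbers and
  the denominator is positive. The filter at 0 excludes z = 0.
\<close>

definition local_power :: "real \<Rightarrow> seq_op \<Rightarrow> (nat \<Rightarrow> complex) \<Rightarrow> ereal" where
  "local_power p T x =
     Limsup (at 0) (\<lambda>z::complex.
       ereal (ln (lp_norm p (lp_resolvent p T z x)) / ln (lp_opnorm p (lp_resolvent p T z))))"

definition power_set :: "real \<Rightarrow> seq_op \<Rightarrow> ereal set" where
  "power_set p T = {local_power p T x | x. x \<in> lp p \<and> x \<noteq> (\<lambda>n. 0)}"

definition forward_weighted_shift :: "real \<Rightarrow> seq_op \<Rightarrow> (nat \<Rightarrow> complex) \<Rightarrow> bool" where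
  "forward_weighted_shift p T w \<longleftrightarrow>
     lp_bounded_operator p T \<and>
     (\<forall>n. T (basis_seq n) = (\<lambda>k. w n * basis_seq (Suc n) k))"

end

theory Submission imports Defs begin

text \<open>
  Write \<open>R z\<close> for the resolvent and \<open>W k\<close> for the product of the first \<open>k\<close> weights. The inequality
  \<open>k\<^sub>x \<le> 1\<close> holds for every nonzero \<open>x\<close>, because \<open>\<parallel>R z x\<parallel> \<le> \<parallel>R z\<parallel> \<parallel>x\<parallel>\<close> and \<open>\<parallel>R z\<parallel>\<close> tends to infinity
  at 0. The point is the lower bound.

  Solving \<open>(z - T) y = x\<close> coordinate by coordinate gives
  \<open>(R z x)\<^sub>k = W k / z ^ (k + 1) * (\<Sum>j\<le>k. x\<^sub>j / W j * z ^ j)\<close>. For \<open>x = e\<^sub>0\<close> the sum is 1; for a vector whose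
  first nonzero coordinate is the one of index \<open>m\<close>, it is \<open>z ^ m\<close> times a polynomial in \<open>z\<close> whose
  constant coefficient is nonzero and the same for all \<open>k \<ge> m\<close>. A polynomial can be small at one
  point of a circle, but the mean of its modulus to the power \<open>p\<close> over the circle is at least that of
  its constant coefficient. Summing this over \<open>k\<close> shows that every circle of small radius \<open>r\<close> contains
  a point \<open>z'\<close> with \<open>\<parallel>R z' x\<parallel> \<ge> c * r ^ m * \<parallel>R r e\<^sub>0\<parallel>\<close>, where \<open>c > 0\<close> does not depend on \<open>r\<close>
  (\<open>exists_rotation_resolvent_comparable\<close>).

  Two facts turn this into \<open>k\<^sub>x \<ge> k\<^bsub>e\<^sub>0\<^esub>\<close>. Multiplying the \<open>n\<close>-th coordinate by \<open>u ^ n\<close> with \<open>\<bar>u\<bar> = 1\<close> is an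
  isometry that conjugates \<open>T\<close> to a rotation of itself, so \<open>\<parallel>R z\<parallel>\<close> depends on \<open>\<bar>z\<bar>\<close> only
  (\<open>lp_opnorm_resolvent_cong\<close>), and passing from \<open>z\<close> to \<open>z'\<close> does not change the denominator in the
  definition of \<open>k\<^sub>x\<close>. As no \<open>W k\<close> vanishes, \<open>\<parallel>R z e\<^sub>0\<parallel>\<close> and hence \<open>\<parallel>R z\<parallel>\<close> grow faster than every power of
  \<open>1 / \<bar>z\<bar>\<close>, so the factor \<open>c * r ^ m\<close> is negligible on the logarithmic scale
  (\<open>affine_ln_over_ln_opnorm_resolvent_tendsto_0\<close>).
\<close>

section \<open>Sequences in the p-summable space\<close>

lemma lp_dominated:
  assumes "x \<in> lp p" and "0 \<le> p" and "\<And>n. cmod (y n) \<le> cmod (x n)"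
  shows "y \<in> lp p"
proof -
  have "summable (\<lambda>n. cmod (y n) powr p)"
    by (rule summable_comparison_test'[of "\<lambda>n. cmod (x n) powr p" 0])
      (use assms in \<open>auto simp: lp_def intro: powr_mono2\<close>)
  then show ?thesis by (simp add: lp_def)
qed

lemma lp_finite_support:
  assumes "finite A" and "\<And>n. n \<notin> A \<Longrightarrow> x n = 0"
  shows "x \<in> lp p"
  unfolding lp_def using assms by (auto intro!: summable_finite[of A])

lemma lp_norm_nonneg: "0 \<le> lp_norm p x"
  by (simp add: lp_norm_def)

lemma lp_norm_powr:
  assumes "x \<in> lp p" and "0 < p"
  shows "lp_norm p x powr p = (\<Sum>n. cmod (x n) powr p)"
proof -
  have "0 \<le> (\<Sum>n. cmod (x n) powr p)"
    using assms by (intro suminf_nonneg) (auto simp: lp_def)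
  then show ?thesis using assms by (simp add: lp_norm_def powr_powr)
qed

lemma sum_le_lp_norm_powr:
  assumes "x \<in> lp p" and "0 < p" and "finite A"
  shows "(\<Sum>n\<in>A. cmod (x n) powr p) \<le> lp_norm p x powr p"
  unfolding lp_norm_powr[OF assms(1,2)] using assms
  by (intro sum_le_suminf) (auto simp: lp_def)

lemma norm_coordinate_le_lp_norm:
  assumes "x \<in> lp p" and "0 < p"
  shows "cmod (x k) \<le> lp_norm p x"
proof -
  have "cmod (x k) powr p \<le> lp_norm p x powr p"
    using sum_le_lp_norm_powr[OF assms, of "{k}"] by simp
  then show ?thesis
    using assms(2) lp_norm_nonneg[of p x] by (meson not_le powr_less_mono2)
qed

lemma lp_norm_scale:
  assumes "x \<in> lp p" and "0 < p"
  shows "lp_norm p (\<lambda>n. c * x n) = cmod c * lp_norm p x"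
proof -
  have s: "summable (\<lambda>n. cmod (x n) powr p)" using assms by (simp add: lp_def)
  then have "0 \<le> (\<Sum>n. cmod (x n) powr p)" by (intro suminf_nonneg) auto
  moreover have "(\<Sum>n. cmod (c * x n) powr p) = cmod c powr p * (\<Sum>n. cmod (x n) powr p)"
    unfolding suminf_mult[OF s, symmetric] by (simp add: norm_mult powr_mult)
  ultimately show ?thesis
    unfolding lp_norm_def using assms(2) by (simp add: powr_mult powr_powr)
qed

lemma lp_scale:
  assumes "x \<in> lp p"
  shows "(\<lambda>n. c * x n) \<in> lp p"
proof -
  have "summable (\<lambda>n. cmod c powr p * cmod (x n) powr p)"
    using assms unfolding lp_def by (intro summable_mult) simp
  then show ?thesis by (simp add: lp_def norm_mult powr_mult)
qed

lemma lp_norm_tail_tendsto_0: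
  assumes "x \<in> lp p" and "0 < p"
  shows "(\<lambda>N. lp_norm p (\<lambda>n. if n < N then 0 else x n)) \<longlonglongrightarrow> 0"
proof -
  let ?f = "\<lambda>n. cmod (x n) powr p"
  have s: "summable ?f" using assms by (simp add: lp_def)
  have eq: "(\<Sum>n. cmod (if n < N then 0 else x n) powr p) = suminf ?f - sum ?f {..<N}" for N
  proof -
    have t: "summable (\<lambda>n. cmod (if n < N then 0 else x n) powr p)"
      using s by (rule summable_comparison_test'[of _ 0]) auto
    show ?thesis
      using suminf_split_initial_segment[OF t, of N] suminf_minus_initial_segment[OF s, of N]
      by simp
  qed
  have "(\<lambda>N. suminf ?f - sum ?f {..<N}) \<longlonglongrightarrow> suminf ?f - suminf ?f"
    by (intro tendsto_intros summable_LIMSEQ s)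
  then have "(\<lambda>N. (suminf ?f - sum ?f {..<N}) powr (1/p)) \<longlonglongrightarrow> (suminf ?f - suminf ?f) powr (1/p)"
    by (rule tendsto_powr'[OF _ tendsto_const]) (use assms(2) sum_le_suminf[OF s] in auto)
  then show ?thesis unfolding lp_norm_def eq by simp
qed

lemma basis_seq_in_lp: "basis_seq n \<in> lp p"
  by (rule lp_finite_support[of "{n}"]) (auto simp: basis_seq_def)

lemma basis_seq_nonzero: "basis_seq n \<noteq> (\<lambda>n. 0)"
  by (metis basis_seq_def zero_neq_one)

lemma lp_norm_le_lp_opnorm:
  assumes "lp_bounded_operator p S" and "x \<in> lp p" and "0 < p"
  shows "lp_norm p (S x) \<le> lp_opnorm p S * lp_norm p x"
proof (cases "lp_norm p x = 0")
  case True
  then show ?thesis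
    using assms(1,2) unfolding lp_bounded_operator_def by fastforce
next
  case False
  let ?t = "lp_norm p x" and ?B = "{x \<in> lp p. lp_norm p x \<le> 1}"
  let ?u = "\<lambda>n. complex_of_real (1 / ?t) * x n"
  have t: "0 < ?t" using False lp_norm_nonneg[of p x] by simp
  obtain C where C: "\<And>x. x \<in> lp p \<Longrightarrow> lp_norm p (S x) \<le> C * lp_norm p x"
    using assms(1) unfolding lp_bounded_operator_def by blast
  have bdd: "bdd_above ((\<lambda>x. lp_norm p (S x)) ` ?B)"
  proof (rule bdd_aboveI2[where M = "max C 0"])
    fix y assume y: "y \<in> ?B"
    have "lp_norm p (S y) \<le> C * lp_norm p y" using y C by simp
    also have "\<dots> \<le> max C 0 * lp_norm p y"
      by (intro mult_right_mono) (auto simp: lp_norm_nonneg)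
    also have "\<dots> \<le> max C 0 * 1" using y by (intro mult_left_mono) auto
    finally show "lp_norm p (S y) \<le> max C 0" by simp
  qed
  have u: "?u \<in> lp p" using assms(2) by (rule lp_scale)
  have "lp_norm p ?u = 1"
    unfolding lp_norm_scale[OF assms(2,3)] using t by (simp add: norm_divide)
  then have "?u \<in> ?B" using u by simp
  then have le: "lp_norm p (S ?u) \<le> lp_opnorm p S"
    unfolding lp_opnorm_def by (intro cSUP_upper bdd)
  have "S ?u = (\<lambda>n. complex_of_real (1 / ?t) * S x n)" and "S x \<in> lp p"
    using assms(1,2) unfolding lp_bounded_operator_def by blast+
  then have "lp_norm p (S ?u) = lp_norm p (S x) / ?t"
    using t assms(3) lp_norm_scale[of "S x" p "complex_of_real (1 / ?t)"] by (simp add: norm_divide)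
  then show ?thesis using le t pos_divide_le_eq[of ?t "lp_norm p (S x)"] by simp
qed

section \<open>Averages over roots of unity\<close>

text \<open>
  The convexity of \<open>x powr p\<close> is extended to the endpoint 0, since the values of polynomials that are
  averaged below may vanish. With one endpoint at 0, convexity says \<open>t powr p \<le> t\<close>.
\<close>

lemma powr_convex_nonneg:
  fixes p :: real
  assumes "1 \<le> p"
  shows "convex_on {0..} (\<lambda>x. x powr p)"
proof (rule convex_onI)
  fix t x y :: real
  assume t: "0 < t" "t < 1" and x: "x \<in> {0..}" and y: "y \<in> {0..}"
  have small: "s powr p \<le> s" if "0 < s" "s < 1" for s :: real
    using powr_mono'[of 1 p s] that assms by simp
  show "((1 - t) *\<^sub>R x + t *\<^sub>R y) powr p \<le> (1 - t) * x powr p + t * y powr p"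
  proof (cases "x = 0 \<or> y = 0")
    case True
    then show ?thesis
      using small[of t] small[of "1 - t"] t x y
      by (auto simp: powr_mult intro!: mult_right_mono)
  next
    case False
    then show ?thesis
      using convex_onD[OF powr_convex[OF assms], of t x y] t x y by simp
  qed
qed simp

text \<open>
  A finite substitute for the mean value over a circle: a power \<open>\<omega> ^ l\<close> with \<open>0 < l < N\<close> is a
  nontrivial \<open>N\<close>-th root of unity, and the powers of such a root sum to 0. So averaging over \<open>N\<close>
  points isolates the constant coefficient of a polynomial of degree below \<open>N\<close>.
\<close>

lemma roots_of_unity_mean:
  fixes c :: "nat \<Rightarrow> complex"
  assumes "d < N" and "\<omega> = exp (2 * of_real pi * \<i> / of_nat N)"
  shows "(\<Sum>i<N. \<Sum>l\<le>d. c l * (\<omega> ^ i) ^ l) = of_nat N * c 0"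
proof -
  have pow: "\<omega> ^ l = exp (2 * of_real pi * \<i> * of_nat l / of_nat N)" for l
    unfolding assms(2) exp_of_nat_mult[symmetric] by (simp add: field_simps)
  have sum0: "(\<Sum>i<N. (\<omega> ^ l) ^ i) = (if l = 0 then of_nat N else 0)" if "l \<le> d" for l
  proof (cases "l = 0")
    case False
    have "\<not> N dvd l" using False that assms(1) by (auto dest: dvd_imp_le)
    then have "\<omega> ^ l \<noteq> 1"
      unfolding pow using complex_root_unity_eq_1[of N l] assms(1) by simp
    moreover have "(\<omega> ^ l) ^ N = 1"
      unfolding pow using complex_root_unity[of N l] assms(1) by simp
    ultimately show ?thesis using False by (simp add: geometric_sum)
  qed simp
  have "(\<Sum>i<N. \<Sum>l\<le>d. c l * (\<omega> ^ i) ^ l) = (\<Sum>l\<le>d. c l * (\<Sum>i<N. (\<omega> ^ l) ^ i))"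
    unfolding sum_distrib_left by (subst sum.swap) (simp add: power_mult[symmetric] mult.commute)
  also have "\<dots> = (\<Sum>l\<le>d. if l = 0 then of_nat N * c 0 else 0)"
    by (intro sum.cong refl) (simp add: sum0)
  finally show ?thesis by simp
qed

text \<open>
  The triangle inequality for the mean, followed by Jensen's inequality. The exponent \<open>p\<close> is kept
  inside the mean, because only in this form can the estimates for single coordinates of a sequence be
  added up to one for its norm.
\<close>

lemma constant_coefficient_powr_le_mean:
  fixes c :: "nat \<Rightarrow> complex"
  assumes "d < N" and "1 \<le> p" and \<omega>: "\<omega> = exp (2 * of_real pi * \<i> / of_nat N)"
  shows "real N * cmod (c 0) powr p \<le> (\<Sum>i<N. cmod (\<Sum>l\<le>d. c l * (\<omega> ^ i) ^ l) powr p)"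
proof -
  let ?q = "\<lambda>i. \<Sum>l\<le>d. c l * (\<omega> ^ i) ^ l"
  have N: "0 < N" using assms(1) by simp
  have "cmod (of_nat N * c 0) \<le> (\<Sum>i<N. cmod (?q i))"
    unfolding roots_of_unity_mean[OF assms(1) \<omega>, symmetric] by (rule norm_sum)
  then have "cmod (c 0) \<le> (\<Sum>i<N. (1 / real N) *\<^sub>R cmod (?q i))"
    using N by (simp add: norm_mult sum_divide_distrib[symmetric] field_simps)
  then have "cmod (c 0) powr p \<le> (\<Sum>i<N. (1 / real N) *\<^sub>R cmod (?q i)) powr p"
    using assms(2) by (intro powr_mono2) auto
  also have "\<dots> \<le> (\<Sum>i<N. (1 / real N) * cmod (?q i) powr p)"
    using N by (intro convex_on_sum[OF _ _ powr_convex_nonneg[OF assms(2)]]) (auto simp: lessThan_empty_iff)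
  finally show ?thesis using N by (simp add: sum_divide_distrib[symmetric] field_simps)
qed

section \<open>The resolvent of a quasinilpotent weighted shift\<close>

locale quasinilpotent_shift =
  fixes p :: real and T :: seq_op and w :: "nat \<Rightarrow> complex"
  assumes p_ge_1: "1 \<le> p"
    and shift: "forward_weighted_shift p T w"
    and w_nonzero: "w n \<noteq> 0"
    and quasinilpotent: "quasinilpotent p T"
begin

lemma p_pos: "0 < p" using p_ge_1 by simp

lemma T_basis: "T (basis_seq n) = (\<lambda>k. w n * basis_seq (Suc n) k)"
  using shift by (simp add: forward_weighted_shift_def)

lemma T_bounded: "lp_bounded_operator p T"
  using shift by (simp add: forward_weighted_shift_def)

lemma T_add: "x \<in> lp p \<Longrightarrow> y \<in> lp p \<Longrightarrow> T (\<lambda>n. x n + y n) = (\<lambda>n. T x n + T y n)"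
  and T_scale: "x \<in> lp p \<Longrightarrow> T (\<lambda>n. c * x n) = (\<lambda>n. c * T x n)"
  and T_in_lp: "x \<in> lp p \<Longrightarrow> T x \<in> lp p"
  using T_bounded unfolding lp_bounded_operator_def by blast+

lemma T_finite_part:
  "T (\<lambda>n. if n < N then x n else 0) = (\<lambda>k. case k of 0 \<Rightarrow> 0 | Suc j \<Rightarrow> if j < N then w j * x j else 0)"
proof (induction N)
  case 0
  show ?case using T_scale[OF basis_seq_in_lp, of 0 0] by (auto simp: fun_eq_iff split: nat.split)
next
  case (Suc N)
  let ?y = "\<lambda>n. if n < N then x n else 0"
  have y: "?y \<in> lp p" by (rule lp_finite_support[of "{..<N}"]) auto
  have "(\<lambda>n. if n < Suc N then x n else 0) = (\<lambda>n. ?y n + x N * basis_seq N n)"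
    by (auto simp: fun_eq_iff basis_seq_def less_Suc_eq)
  then have "T (\<lambda>n. if n < Suc N then x n else 0) = (\<lambda>k. T ?y k + x N * (w N * basis_seq (Suc N) k))"
    using T_add[OF y lp_scale[OF basis_seq_in_lp]] T_scale[OF basis_seq_in_lp] T_basis by simp
  also have "\<dots> = (\<lambda>k. case k of 0 \<Rightarrow> 0 | Suc j \<Rightarrow> if j < Suc N then w j * x j else 0)"
    unfolding Suc.IH by (auto simp: fun_eq_iff basis_seq_def less_Suc_eq split: nat.split)
  finally show ?case .
qed

text \<open>
  Linearity determines \<open>T\<close> on finitely supported sequences only. Boundedness carries the formula
  over to the whole space, since the tails of a sequence tend to 0 in norm.
\<close>

lemma T_coordinates:
  assumes x: "x \<in> lp p"
  shows "T x k = (case k of 0 \<Rightarrow> 0 | Suc j \<Rightarrow> w j * x j)" (is "_ = ?v")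
proof -
  obtain C where C: "\<And>x. x \<in> lp p \<Longrightarrow> lp_norm p (T x) \<le> C * lp_norm p x"
    using T_bounded unfolding lp_bounded_operator_def by blast
  let ?t = "\<lambda>N n. if n < N then 0 else x n"
  have t: "?t N \<in> lp p" for N using x p_pos by (auto intro: lp_dominated)
  have bound: "cmod (T x k - ?v) \<le> C * lp_norm p (?t N)" if "k \<le> N" for N
  proof -
    let ?y = "\<lambda>n. if n < N then x n else 0"
    have y: "?y \<in> lp p" by (rule lp_finite_support[of "{..<N}"]) auto
    have "x = (\<lambda>n. ?y n + ?t N n)" by auto
    then have "T x k = T ?y k + T (?t N) k" using T_add[OF y t[of N]] by metis
    moreover have "T ?y k = ?v" unfolding T_finite_part using that by (auto split: nat.split)
    ultimately have "cmod (T x k - ?v) = cmod (T (?t N) k)" by simp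
    also have "\<dots> \<le> lp_norm p (T (?t N))"
      by (rule norm_coordinate_le_lp_norm[OF T_in_lp[OF t] p_pos])
    finally show ?thesis using C[OF t[of N]] by linarith
  qed
  have "(\<lambda>N. C * lp_norm p (?t N)) \<longlonglongrightarrow> C * 0"
    by (intro tendsto_intros lp_norm_tail_tendsto_0 x p_pos)
  then have "cmod (T x k - ?v) \<le> C * 0"
    by (rule LIMSEQ_le_const) (use bound in blast)
  then show ?thesis by simp
qed

abbreviation R :: "complex \<Rightarrow> seq_op" where "R \<equiv> lp_resolvent p T"

lemma resolvent_is_bounded_inverse:
  assumes "z \<noteq> 0"
  shows "\<exists>S. lp_bounded_operator p S \<and> (\<forall>x\<in>lp p. R z x = S x \<and> scalar_minus z T (S x) = x)"
proof -
  have "z \<notin> lp_spectrum p T" using quasinilpotent assms by (simp add: quasinilpotent_def)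
  then obtain S where S: "lp_bounded_operator p S"
    "\<And>x. x \<in> lp p \<Longrightarrow> S (scalar_minus z T x) = x" "\<And>x. x \<in> lp p \<Longrightarrow> scalar_minus z T (S x) = x"
    unfolding lp_spectrum_def lp_invertible_def by blast
  have inj: "inj_on (scalar_minus z T) (lp p)"
    by (intro inj_on_inverseI[where g = S]) (simp add: S(2))
  have "R z x = S x" if x: "x \<in> lp p" for x
  proof -
    have "S x \<in> lp p" using S(1) x unfolding lp_bounded_operator_def by blast
    then show ?thesis
      unfolding lp_resolvent_def using inv_into_f_f[OF inj, of "S x"] S(3)[OF x] by simp
  qed
  then show ?thesis using S(1,3) by blast
qed

lemma resolvent_in_lp:
  assumes "z \<noteq> 0" and "x \<in> lp p"
  shows "R z x \<in> lp p"
  using resolvent_is_bounded_inverse[OF assms(1)] assms(2) unfolding lp_bounded_operator_def by auto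

lemma scalar_minus_resolvent:
  assumes "z \<noteq> 0" and "x \<in> lp p"
  shows "scalar_minus z T (R z x) = x"
  using resolvent_is_bounded_inverse[OF assms(1)] assms(2) by auto

lemma lp_norm_resolvent_le:
  assumes "z \<noteq> 0" and x: "x \<in> lp p"
  shows "lp_norm p (R z x) \<le> lp_opnorm p (R z) * lp_norm p x"
proof -
  obtain S where S: "lp_bounded_operator p S" "\<And>x. x \<in> lp p \<Longrightarrow> R z x = S x"
    using resolvent_is_bounded_inverse[OF assms(1)] by blast
  have "lp_opnorm p (R z) = lp_opnorm p S"
    unfolding lp_opnorm_def by (intro SUP_cong) (auto simp: S(2))
  then show ?thesis using lp_norm_le_lp_opnorm[OF S(1) x p_pos] S(2)[OF x] by simp
qed

definition W :: "nat \<Rightarrow> complex" where "W k = (\<Prod>i<k. w i)"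

lemma W_nonzero: "W k \<noteq> 0" by (simp add: W_def w_nonzero)

lemma W_Suc: "W (Suc k) = w k * W k" by (simp add: W_def)

text \<open>
  The equation \<open>(z - T) y = x\<close> is the recurrence \<open>z * y\<^sub>0 = x\<^sub>0\<close>,
  \<open>z * y\<^bsub>k+1\<^esub> = x\<^bsub>k+1\<^esub> + w k * y\<^sub>k\<close>. In terms of \<open>z ^ (k + 1) * y\<^sub>k / W k\<close> it only adds one term in each
  step, which explains the partial sums.
\<close>

lemma resolvent_coordinates:
  assumes z: "z \<noteq> 0" and x: "x \<in> lp p"
  shows "R z x k = W k / z ^ Suc k * (\<Sum>j\<le>k. x j / W j * z ^ j)"
proof -
  have eq: "z * R z x k - (case k of 0 \<Rightarrow> 0 | Suc j \<Rightarrow> w j * R z x j) = x k" for k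
    using fun_cong[OF scalar_minus_resolvent[OF z x], of k]
    by (simp add: scalar_minus_def T_coordinates[OF resolvent_in_lp[OF z x]])
  show ?thesis
  proof (induction k)
    case 0
    show ?case using eq[of 0] z by (simp add: W_def field_simps)
  next
    case (Suc k)
    have "z * R z x (Suc k) = x (Suc k) + w k * R z x k" using eq[of "Suc k"] by (simp add: field_simps)
    also have "x (Suc k) = W (Suc k) / z ^ Suc k * (x (Suc k) / W (Suc k) * z ^ Suc k)"
      using z W_nonzero[of "Suc k"] by simp
    also have "\<dots> + w k * R z x k = W (Suc k) / z ^ Suc k * (\<Sum>j\<le>Suc k. x j / W j * z ^ j)"
      unfolding Suc.IH W_Suc sum.atMost_Suc distrib_left by simp
    finally have "R z x (Suc k) = W (Suc k) / z ^ Suc k * (\<Sum>j\<le>Suc k. x j / W j * z ^ j) / z"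
      using z by (metis nonzero_mult_div_cancel_left)
    then show ?case by simp
  qed
qed

lemma resolvent_basis_0_coordinates:
  assumes "z \<noteq> 0"
  shows "R z (basis_seq 0) k = W k / z ^ Suc k"
proof -
  have "(\<Sum>j\<le>k. basis_seq 0 j / W j * z ^ j) = (\<Sum>j\<le>k. if j = 0 then 1 else 0)"
    by (intro sum.cong) (auto simp: basis_seq_def W_def)
  also have "\<dots> = 1" by simp
  finally show ?thesis unfolding resolvent_coordinates[OF assms basis_seq_in_lp] by simp
qed

text \<open>
  With \<open>U\<close> the diagonal isometry \<open>x \<mapsto> (\<lambda>n. u ^ n * x n)\<close>, the resolvent at \<open>u * z\<close> is
  \<open>u\<inverse> U\<inverse> R z U\<close>, and the two left factors preserve the norm.
\<close>

lemma lp_norm_resolvent_rotate: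
  assumes "cmod u = 1" and z: "z \<noteq> 0" and x: "x \<in> lp p"
  shows "lp_norm p (R (u * z) x) = lp_norm p (R z (\<lambda>n. u ^ n * x n))"
proof -
  have uz: "u * z \<noteq> 0" using assms(1) z by auto
  have y: "(\<lambda>n. u ^ n * x n) \<in> lp p"
    using x p_pos by (rule lp_dominated[OF _ less_imp_le]) (auto simp: norm_mult norm_power assms(1))
  have "cmod (R (u * z) x k) = cmod (R z (\<lambda>n. u ^ n * x n) k)" for k
  proof -
    have "(\<Sum>j\<le>k. x j / W j * (u * z) ^ j) = (\<Sum>j\<le>k. u ^ j * x j / W j * z ^ j)"
      by (intro sum.cong refl) (simp add: power_mult_distrib mult_ac)
    then have "R (u * z) x k = R z (\<lambda>n. u ^ n * x n) k / u ^ Suc k"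
      unfolding resolvent_coordinates[OF z y] resolvent_coordinates[OF uz x] power_mult_distrib
      by (simp del: power_Suc)
    then show ?thesis by (simp add: norm_divide norm_power assms(1) del: power_Suc)
  qed
  then show ?thesis unfolding lp_norm_def by simp
qed

lemma lp_opnorm_resolvent_rotate_le:
  assumes u: "cmod u = 1" and z: "z \<noteq> 0"
  shows "lp_opnorm p (R (u * z)) \<le> lp_opnorm p (R z)"
proof -
  let ?B = "{x \<in> lp p. lp_norm p x \<le> 1}"
  have "(\<lambda>n. 0) \<in> ?B" by (auto simp: lp_def lp_norm_def)
  then have ne: "?B \<noteq> {}" by blast
  have pos: "0 \<le> lp_opnorm p (R z)"
  proof -
    have "0 < cmod (1 / z)" using z by simp
    also have "\<dots> \<le> lp_norm p (R z (basis_seq 0))"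
      using norm_coordinate_le_lp_norm[OF resolvent_in_lp[OF z basis_seq_in_lp] p_pos, of 0 0]
      by (simp add: resolvent_basis_0_coordinates[OF z] W_def)
    also have "\<dots> \<le> lp_opnorm p (R z) * lp_norm p (basis_seq 0)"
      by (rule lp_norm_resolvent_le[OF z basis_seq_in_lp])
    finally show ?thesis using lp_norm_nonneg[of p "basis_seq 0"] by (simp add: zero_less_mult_iff)
  qed
  show ?thesis unfolding lp_opnorm_def[of p "R (u * z)"]
  proof (rule cSUP_least[OF ne])
    fix x assume x: "x \<in> ?B"
    have y: "(\<lambda>n. u ^ n * x n) \<in> lp p"
      by (rule lp_dominated[of x]) (use x p_pos in \<open>auto simp: norm_mult norm_power u\<close>)
    have "lp_norm p (\<lambda>n. u ^ n * x n) = lp_norm p x"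
      by (simp add: lp_norm_def norm_mult norm_power u)
    then have "lp_norm p (R (u * z) x) \<le> lp_opnorm p (R z) * lp_norm p x"
      using lp_norm_resolvent_rotate[OF u z, of x] lp_norm_resolvent_le[OF z y] x by simp
    also have "\<dots> \<le> lp_opnorm p (R z) * 1" using x pos by (intro mult_left_mono) auto
    finally show "lp_norm p (R (u * z) x) \<le> lp_opnorm p (R z)" by simp
  qed
qed

lemma lp_opnorm_resolvent_cong:
  assumes "cmod z = cmod z'" and "z \<noteq> 0"
  shows "lp_opnorm p (R z) = lp_opnorm p (R z')"
proof -
  have z': "z' \<noteq> 0" using assms by auto
  have "cmod (z / z') = 1" and "cmod (z' / z) = 1"
    using assms z' by (auto simp: norm_divide)
  from lp_opnorm_resolvent_rotate_le[OF this(1) z'] lp_opnorm_resolvent_rotate_le[OF this(2) assms(2)]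
  show ?thesis using assms(2) z' by simp
qed

section \<open>Comparison with the resolvent at the first basis vector\<close>

lemma sum_atMost_skip_zeros:
  fixes f :: "nat \<Rightarrow> complex"
  assumes "\<And>j. j < m \<Longrightarrow> f j = 0"
  shows "(\<Sum>j\<le>m + d. f j) = (\<Sum>l\<le>d. f (m + l))"
proof (induction d)
  case 0
  have "(\<Sum>j\<le>m. f j) = (\<Sum>j<m. f j) + f m"
    by (simp add: lessThan_Suc_atMost[symmetric])
  then show ?case using assms by simp
qed simp

text \<open>
  For \<open>k \<ge> m\<close> the \<open>k\<close>-th coordinate of \<open>R z' x\<close> is that of \<open>R z' e\<^sub>0\<close> times \<open>z' ^ m\<close> times a
  polynomial in \<open>z'\<close> with constant coefficient \<open>x m / W m\<close>. As \<open>z'\<close> runs through the points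
  \<open>\<omega> ^ i * z\<close>, the mean of the \<open>p\<close>-th powers of these moduli is bounded below by means of that
  coefficient, and some single point does at least as well as the mean for all \<open>k\<close> in a finite range
  together. The range is chosen to carry a fixed proportion of the \<open>p\<close>-th power of the norm of
  \<open>R z e\<^sub>0\<close>: far enough out to lose at most half of it, while the coordinates below \<open>m\<close> are dominated by the one at \<open>m\<close>, uniformly
  for \<open>\<bar>z\<bar> \<le> 1\<close>. The number of roots of unity depends on \<open>z\<close>, but the constant \<open>c\<close> does not.
\<close>

lemma exists_rotation_resolvent_comparable:
  assumes x: "x \<in> lp p" and zeros: "\<And>j. j < m \<Longrightarrow> x j = 0" and nz: "x m \<noteq> 0"
  shows "\<exists>c>0. \<forall>z. z \<noteq> 0 \<and> cmod z \<le> 1 \<longrightarrow>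
    (\<exists>z'. cmod z' = cmod z \<and> c * cmod z ^ m * lp_norm p (R z (basis_seq 0)) \<le> lp_norm p (R z' x))"
proof -
  define a where "a j = x j / W j" for j
  define D where "D = (\<Sum>k<m. (cmod (W k) / cmod (W m)) powr p)"
  \<comment> \<open>In the \<open>p\<close>-th power of the norm the tail costs the factor 2, and the coordinates below \<open>m\<close> cost the factor \<open>1 + D\<close>.\<close>
  define c where "c = cmod (a m) * (1 / (2 * (1 + D))) powr (1 / p)"
  have D: "0 \<le> D" unfolding D_def by (intro sum_nonneg) simp
  have am: "0 < cmod (a m)" using nz W_nonzero by (simp add: a_def)
  have "0 < c" using am D by (simp add: c_def)
  moreover have "\<exists>z'. cmod z' = cmod z \<and> c * cmod z ^ m * lp_norm p (R z (basis_seq 0)) \<le> lp_norm p (R z' x)"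
    if z: "z \<noteq> 0" and z1: "cmod z \<le> 1" for z
  proof -
    define E where "E k = cmod (R z (basis_seq 0) k)" for k
    define S where "S = lp_norm p (R z (basis_seq 0)) powr p"
    define t where "t = cmod z ^ m * cmod (a m)"
    have E: "E k = cmod (W k) / cmod z ^ Suc k" for k
      by (simp add: E_def resolvent_basis_0_coordinates[OF z] norm_divide norm_power norm_mult)
    have E_pos: "0 < E k" for k using z W_nonzero by (simp add: E)
    have Rz: "R z (basis_seq 0) \<in> lp p" by (rule resolvent_in_lp[OF z basis_seq_in_lp])
    have S_eq: "S = (\<Sum>k. E k powr p)" unfolding S_def E_def by (rule lp_norm_powr[OF Rz p_pos])
    have summ: "summable (\<lambda>k. E k powr p)" using Rz by (simp add: lp_def E_def)
    have "0 < S"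
      using sum_le_lp_norm_powr[OF Rz p_pos, of "{0}"] E_pos[of 0] unfolding S_def E_def
      by (auto intro: less_le_trans[rotated])
    then have "S / 2 < S" by simp
    then have "eventually (\<lambda>n. S / 2 < (\<Sum>k<n. E k powr p)) sequentially"
      unfolding S_eq by (rule order_tendstoD(1)[OF summable_LIMSEQ[OF summ]])
    then obtain N0 where N0: "\<And>n. N0 \<le> n \<Longrightarrow> S / 2 < (\<Sum>k<n. E k powr p)"
      unfolding eventually_sequentially by blast
    \<comment> \<open>For indices in \<open>{m..<m + N}\<close> the polynomials have degree below \<open>N\<close>, so \<open>N\<close> roots of unity suffice.\<close>
    define N where "N = Suc N0"
    define B where "B = (\<Sum>k\<in>{m..<m + N}. E k powr p)"
    have N: "0 < N" by (simp add: N_def)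
    have head: "(\<Sum>k<m. E k powr p) \<le> D * E m powr p"
      unfolding D_def sum_distrib_right
    proof (rule sum_mono)
      fix k assume "k \<in> {..<m}"
      then have "cmod z ^ Suc m \<le> cmod z ^ Suc k" using z1 by (intro power_decreasing) auto
      then have "E k \<le> cmod (W k) / cmod z ^ Suc m"
        unfolding E using z by (intro divide_left_mono) auto
      also have "\<dots> = cmod (W k) / cmod (W m) * E m" using W_nonzero by (simp add: E)
      finally have "E k powr p \<le> (cmod (W k) / cmod (W m) * E m) powr p"
        using E_pos[of k] p_pos by (intro powr_mono2) auto
      then show "E k powr p \<le> (cmod (W k) / cmod (W m)) powr p * E m powr p"
        by (simp only: powr_mult)
    qed
    have "E m powr p \<le> B"
      unfolding B_def using N by (intro member_le_sum) auto
    then have "D * E m powr p \<le> D * B" using D by (rule mult_left_mono)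
    moreover have "(\<Sum>k<m + N. E k powr p) = (\<Sum>k<m. E k powr p) + B"
      unfolding B_def using sum.atLeastLessThan_concat[of 0 m "m + N" "\<lambda>k. E k powr p"]
      by (simp add: lessThan_atLeast0)
    ultimately have SB: "S / 2 < (1 + D) * B"
      using N0[of "m + N"] head by (simp add: N_def distrib_right)

    define \<omega> where "\<omega> = exp (2 * of_real pi * \<i> / of_nat N)"
    have \<omega>: "cmod (\<omega> ^ i) = 1" for i
    proof -
      have "\<omega> = exp (\<i> * of_real (2 * pi / real N))" by (simp add: \<omega>_def mult_ac)
      then show ?thesis by (simp add: norm_power)
    qed
    define v where "v i = lp_norm p (R (\<omega> ^ i * z) x) powr p" for i
    have nonzero: "\<omega> ^ i * z \<noteq> 0" for i using z by (simp add: \<omega>_def)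
    have coord: "real N * (E k * t) powr p \<le> (\<Sum>i<N. cmod (R (\<omega> ^ i * z) x k) powr p)"
      if k: "k \<in> {m..<m + N}" for k
    proof -
      obtain d where d: "k = m + d" "d < N" using k le_Suc_ex by fastforce
      define q where "q i = (\<Sum>l\<le>d. (a (m + l) * z ^ l) * (\<omega> ^ i) ^ l)" for i
      have eq: "cmod (R (\<omega> ^ i * z) x k) = E k * cmod z ^ m * cmod (q i)" for i
      proof -
        have "(\<Sum>j\<le>k. x j / W j * (\<omega> ^ i * z) ^ j)
            = (\<Sum>l\<le>d. x (m + l) / W (m + l) * (\<omega> ^ i * z) ^ (m + l))"
          unfolding d(1) by (rule sum_atMost_skip_zeros) (simp add: zeros)
        also have "\<dots> = (\<omega> ^ i * z) ^ m * q i"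
          unfolding q_def sum_distrib_left
          by (intro sum.cong refl) (simp add: a_def power_add power_mult_distrib mult_ac)
        finally show ?thesis
          unfolding resolvent_coordinates[OF nonzero x] E
          by (simp add: norm_mult norm_divide norm_power[of _ "Suc k"] norm_power[of _ m] \<omega> del: power_Suc)
      qed
      have "real N * (E k * t) powr p = (E k * cmod z ^ m) powr p * (real N * cmod (a (m + 0) * z ^ 0) powr p)"
        using powr_mult[of "E k * cmod z ^ m" "cmod (a m)" p] by (simp add: t_def mult_ac)
      also have "\<dots> \<le> (E k * cmod z ^ m) powr p * (\<Sum>i<N. cmod (q i) powr p)"
        unfolding q_def
        by (intro mult_left_mono constant_coefficient_powr_le_mean[OF d(2) p_ge_1 \<omega>_def]) simp
      also have "\<dots> = (\<Sum>i<N. cmod (R (\<omega> ^ i * z) x k) powr p)"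
        unfolding sum_distrib_left eq by (simp add: powr_mult)
      finally show ?thesis .
    qed
    have "real N * (t powr p * B) = (\<Sum>k\<in>{m..<m + N}. real N * (E k * t) powr p)"
      unfolding B_def sum_distrib_left by (simp add: powr_mult mult_ac)
    also have "\<dots> \<le> (\<Sum>k\<in>{m..<m + N}. \<Sum>i<N. cmod (R (\<omega> ^ i * z) x k) powr p)"
      by (intro sum_mono coord)
    also have "\<dots> = (\<Sum>i<N. \<Sum>k\<in>{m..<m + N}. cmod (R (\<omega> ^ i * z) x k) powr p)"
      by (rule sum.swap)
    also have "\<dots> \<le> (\<Sum>i<N. v i)"
      unfolding v_def
      by (intro sum_mono sum_le_lp_norm_powr resolvent_in_lp nonzero x p_pos) simp
    finally have total: "real N * (t powr p * B) \<le> (\<Sum>i<N. v i)" .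
    have "\<exists>i<N. t powr p * B \<le> v i"
    proof (rule ccontr)
      assume "\<not> (\<exists>i<N. t powr p * B \<le> v i)"
      then have "(\<Sum>i<N. v i) < (\<Sum>i<N. t powr p * B)"
        using N by (intro sum_strict_mono) (auto simp: not_le)
      then show False using total by simp
    qed
    then obtain i where i: "t powr p * B \<le> v i" by blast
    have "(c * cmod z ^ m * lp_norm p (R z (basis_seq 0))) powr p = t powr p * (S / (2 * (1 + D)))"
      unfolding c_def t_def S_def using p_pos D by (simp add: powr_mult powr_powr mult_ac)
    also have "\<dots> \<le> t powr p * B"
      using SB D by (intro mult_left_mono) (auto simp: field_simps)
    also have "\<dots> \<le> lp_norm p (R (\<omega> ^ i * z) x) powr p" using i by (simp add: v_def)
    finally have "c * cmod z ^ m * lp_norm p (R z (basis_seq 0)) \<le> lp_norm p (R (\<omega> ^ i * z) x)"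
      using p_pos lp_norm_nonneg[of p "R (\<omega> ^ i * z) x"] by (meson not_le powr_less_mono2)
    then show ?thesis using \<omega>[of i] by (intro exI[of _ "\<omega> ^ i * z"]) (simp add: norm_mult)
  qed
  ultimately show ?thesis by blast
qed

section \<open>Logarithmic growth of the resolvent\<close>

lemma lp_norm_resolvent_basis_le_opnorm:
  assumes "z \<noteq> 0"
  shows "lp_norm p (R z (basis_seq 0)) \<le> lp_opnorm p (R z)"
proof -
  have "(\<Sum>n. cmod (basis_seq 0 n) powr p) = 1"
    by (subst suminf_finite[of "{0}"]) (auto simp: basis_seq_def)
  then have "lp_norm p (basis_seq 0) = 1" by (simp add: lp_norm_def)
  then show ?thesis using lp_norm_resolvent_le[OF assms basis_seq_in_lp, of 0] by simp
qed

lemma coefficient_le_lp_norm_resolvent_basis: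
  assumes "z \<noteq> 0"
  shows "cmod (W k) / cmod z ^ Suc k \<le> lp_norm p (R z (basis_seq 0))"
  using norm_coordinate_le_lp_norm[OF resolvent_in_lp[OF assms basis_seq_in_lp] p_pos, of 0 k]
  by (simp add: resolvent_basis_0_coordinates[OF assms] norm_divide norm_mult norm_power)

lemma lp_norm_resolvent_basis_pos:
  assumes "z \<noteq> 0"
  shows "0 < lp_norm p (R z (basis_seq 0))"
proof -
  have "0 < cmod (W 0) / cmod z ^ Suc 0" using assms W_nonzero by simp
  then show ?thesis using coefficient_le_lp_norm_resolvent_basis[OF assms, of 0] by linarith
qed

lemma minus_ln_norm_at_top: "filterlim (\<lambda>z::complex. - ln (cmod z)) at_top (at 0)"
proof -
  have "filterlim cmod (at_right 0) (at 0)"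
    unfolding filterlim_at
    using tendsto_norm_zero[OF tendsto_ident_at[of "0::complex" UNIV]]
    by (auto simp: eventually_at intro!: exI[of _ 1])
  then have "filterlim (\<lambda>z::complex. ln (cmod z)) at_bot (at 0)"
    by (rule filterlim_compose[OF ln_at_0])
  then show ?thesis by (simp add: filterlim_uminus_at_top)
qed

text \<open>
  The \<open>k\<close>-th coordinate of \<open>R z e\<^sub>0\<close> has modulus \<open>\<bar>W k\<bar> / \<bar>z\<bar> ^ (k + 1)\<close>. One of the \<open>k + 1\<close>
  factors \<open>1 / \<bar>z\<bar>\<close> absorbs the constant \<open>\<bar>W k\<bar>\<close> near 0.
\<close>

lemma eventually_ln_opnorm_resolvent_ge:
  "eventually (\<lambda>z. real k * (- ln (cmod z)) \<le> ln (lp_opnorm p (R z))) (at 0)"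
proof -
  have "eventually (\<lambda>z::complex. - ln (cmod (W k)) \<le> - ln (cmod z)) (at 0)"
    using minus_ln_norm_at_top unfolding filterlim_at_top by blast
  moreover have "eventually (\<lambda>z::complex. z \<noteq> 0) (at 0)" by (simp add: eventually_at_filter)
  ultimately show ?thesis
  proof eventually_elim
    case (elim z)
    have pos: "0 < cmod (W k) / cmod z ^ Suc k" using elim W_nonzero by simp
    have "real k * (- ln (cmod z)) \<le> ln (cmod (W k)) - real (Suc k) * ln (cmod z)"
      using elim by (simp add: algebra_simps)
    also have "\<dots> = ln (cmod (W k) / cmod z ^ Suc k)"
      using elim W_nonzero[of k] by (subst ln_div) (auto simp: ln_realpow simp del: power_Suc)
    also have "\<dots> \<le> ln (lp_opnorm p (R z))"
      using coefficient_le_lp_norm_resolvent_basis[of z k] lp_norm_resolvent_basis_le_opnorm[of z]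
        elim pos by (intro ln_mono) linarith+
    finally show ?case .
  qed
qed

lemma ln_opnorm_resolvent_at_top: "filterlim (\<lambda>z. ln (lp_opnorm p (R z))) at_top (at 0)"
  by (rule filterlim_at_top_mono[OF minus_ln_norm_at_top])
    (use eventually_ln_opnorm_resolvent_ge[of 1] in simp)

lemma ln_norm_over_ln_opnorm_resolvent_tendsto_0:
  "((\<lambda>z. ln (cmod z) / ln (lp_opnorm p (R z))) \<longlongrightarrow> 0) (at 0)"
proof (rule tendstoI)
  fix e :: real assume e: "0 < e"
  obtain k where k: "inverse (real (Suc k)) < e" using reals_Archimedean[OF e] by blast
  have "eventually (\<lambda>z::complex. 1 \<le> - ln (cmod z)) (at 0)"
    using minus_ln_norm_at_top unfolding filterlim_at_top by blast
  with eventually_ln_opnorm_resolvent_ge[of "Suc k"]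
  show "eventually (\<lambda>z. dist (ln (cmod z) / ln (lp_opnorm p (R z))) 0 < e) (at 0)"
  proof eventually_elim
    case (elim z)
    let ?L = "- ln (cmod z)" and ?M = "ln (lp_opnorm p (R z))"
    have "0 < real (Suc k) * ?L" using elim by (intro mult_pos_pos) auto
    then have M: "0 < ?M" using elim(1) by linarith
    have "?L \<le> inverse (real (Suc k)) * ?M"
      using elim(1) by (simp add: field_simps del: of_nat_Suc)
    also have "\<dots> < e * ?M" using k M by (rule mult_strict_right_mono)
    finally have "?L / ?M < e" unfolding pos_divide_less_eq[OF M] .
    then show ?case using elim(2) M by (simp add: dist_real_def abs_if divide_neg_pos)
  qed
qed

text \<open>The logarithm of a factor \<open>exp C * \<bar>z\<bar> ^ M\<close> is negligible against \<open>ln \<parallel>R z\<parallel>\<close>.\<close>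

lemma affine_ln_over_ln_opnorm_resolvent_tendsto_0:
  "((\<lambda>z. (C + M * ln (cmod z)) / ln (lp_opnorm p (R z))) \<longlongrightarrow> 0) (at 0)"
proof -
  have "((\<lambda>z. C / ln (lp_opnorm p (R z)) + M * (ln (cmod z) / ln (lp_opnorm p (R z)))) \<longlongrightarrow> 0 + M * 0) (at 0)"
    by (intro tendsto_intros ln_norm_over_ln_opnorm_resolvent_tendsto_0
        real_tendsto_divide_at_top[OF tendsto_const ln_opnorm_resolvent_at_top])
  then show ?thesis by (simp add: add_divide_distrib)
qed

lemma eventually_ln_opnorm_resolvent_pos: "eventually (\<lambda>z. 0 < ln (lp_opnorm p (R z))) (at 0)"
  using ln_opnorm_resolvent_at_top by (simp add: filterlim_at_top_dense)

lemma local_power_le_1: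
  assumes x: "x \<in> lp p" and nz: "x \<noteq> (\<lambda>n. 0)"
  shows "local_power p T x \<le> 1"
proof -
  obtain m where m: "x m \<noteq> 0" using nz by auto
  have x_pos: "0 < lp_norm p x"
    using norm_coordinate_le_lp_norm[OF x p_pos, of m] m
    by (meson less_le_trans zero_less_norm_iff)
  let ?M = "\<lambda>z. ln (lp_opnorm p (R z))"
  have "eventually (\<lambda>z::complex. z \<noteq> 0) (at 0)" by (simp add: eventually_at_filter)
  with eventually_ln_opnorm_resolvent_pos
  have "eventually (\<lambda>z. ereal (ln (lp_norm p (R z x)) / ?M z)
      \<le> ereal (1 + (ln (lp_norm p x) + 0 * ln (cmod z)) / ?M z)) (at 0)"
  proof eventually_elim
    case (elim z)
    have Rx: "R z x \<in> lp p" using resolvent_in_lp elim x by simp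
    have R_pos: "0 < lp_norm p (R z x)"
    proof (rule ccontr)
      assume "\<not> 0 < lp_norm p (R z x)"
      then have zero: "R z x k = 0" for k
        using norm_coordinate_le_lp_norm[OF Rx p_pos, of k] by (simp add: not_less norm_le_zero_iff[symmetric] del: norm_le_zero_iff)
      have "x m = scalar_minus z T (R z x) m" using scalar_minus_resolvent[of z x] elim x by simp
      also have "\<dots> = 0"
        by (simp add: scalar_minus_def T_coordinates[OF Rx] zero split: nat.split)
      finally show False using m by simp
    qed
    have op_pos: "0 < lp_opnorm p (R z)"
      using lp_norm_resolvent_basis_pos[of z] lp_norm_resolvent_basis_le_opnorm[of z] elim by simp
    have "ln (lp_norm p (R z x)) \<le> ln (lp_opnorm p (R z) * lp_norm p x)"
      using lp_norm_resolvent_le[of z x] elim x R_pos by (intro ln_mono) auto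
    also have "\<dots> = ?M z + ln (lp_norm p x)" using op_pos x_pos by (simp add: ln_mult)
    finally show ?case using elim(1) by (simp add: field_simps)
  qed
  then have "local_power p T x
      \<le> Limsup (at 0) (\<lambda>z. ereal (1 + (ln (lp_norm p x) + 0 * ln (cmod z)) / ?M z))"
    unfolding local_power_def by (rule Limsup_mono)
  also have "\<dots> = ereal (1 + 0)"
    by (intro lim_imp_Limsup tendsto_ereal tendsto_add tendsto_const
        affine_ln_over_ln_opnorm_resolvent_tendsto_0) simp
  finally show ?thesis by (simp add: one_ereal_def)
qed

text \<open>
  If the quotient for \<open>x\<close> stayed below some \<open>d < 1\<close> near 0, it would do so on full circles, in
  particular at the point \<open>z'\<close> where \<open>R z' x\<close> is comparable to \<open>R z e\<^sub>0\<close>. Then the quotient for \<open>e\<^sub>0\<close>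
  at \<open>z\<close> would be below \<open>d\<close> up to an error that tends to 0, and its limit superior would be less than 1.
\<close>

lemma local_power_ge_1:
  assumes x: "x \<in> lp p" and nz: "x \<noteq> (\<lambda>n. 0)" and e0: "local_power p T (basis_seq 0) = 1"
  shows "1 \<le> local_power p T x"
proof (rule ccontr)
  assume "\<not> 1 \<le> local_power p T x"
  then obtain d where d: "local_power p T x < ereal d" "ereal d < 1"
    using ereal_dense2[of "local_power p T x" 1] by (auto simp: not_le)
  let ?M = "\<lambda>z. ln (lp_opnorm p (R z))"
  have "eventually (\<lambda>z. ereal (ln (lp_norm p (R z x)) / ?M z) < ereal d) (at 0)"
    using d(1) unfolding local_power_def by (rule Limsup_lessD)
  then obtain \<delta> where \<delta>: "0 < \<delta>"
    "\<And>z. z \<noteq> 0 \<Longrightarrow> cmod z < \<delta> \<Longrightarrow> ln (lp_norm p (R z x)) / ?M z < d"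
    by (auto simp: eventually_at dist_norm)
  define m where "m = (LEAST j. x j \<noteq> 0)"
  obtain j where "x j \<noteq> 0" using nz by auto
  then have m: "x m \<noteq> 0" unfolding m_def by (rule LeastI)
  have zeros: "x j = 0" if "j < m" for j using not_less_Least[OF that[unfolded m_def]] by simp
  obtain c where c: "0 < c" "\<And>z. z \<noteq> 0 \<Longrightarrow> cmod z \<le> 1 \<Longrightarrow> \<exists>z'. cmod z' = cmod z \<and>
      c * cmod z ^ m * lp_norm p (R z (basis_seq 0)) \<le> lp_norm p (R z' x)"
    using exists_rotation_resolvent_comparable[OF x zeros m] by blast
  let ?h = "\<lambda>z. (ln c + real m * ln (cmod z)) / ?M z"
  have "eventually (\<lambda>z. - ((1 - d) / 2) < ?h z) (at 0)"
    using d(2) by (intro order_tendstoD(1)[OF affine_ln_over_ln_opnorm_resolvent_tendsto_0])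
      (simp add: one_ereal_def)
  moreover have "eventually (\<lambda>z::complex. z \<noteq> 0 \<and> cmod z \<le> 1 \<and> cmod z < \<delta>) (at 0)"
    using \<delta>(1) by (auto simp: eventually_at dist_norm intro!: exI[of _ "min \<delta> 1"])
  ultimately have "eventually (\<lambda>z. ereal (ln (lp_norm p (R z (basis_seq 0))) / ?M z) \<le> ereal ((1 + d) / 2)) (at 0)"
    using eventually_ln_opnorm_resolvent_pos
  proof eventually_elim
    case (elim z)
    let ?b = "lp_norm p (R z (basis_seq 0))"
    have z: "z \<noteq> 0" using elim by simp
    obtain z' where z': "cmod z' = cmod z" "c * cmod z ^ m * ?b \<le> lp_norm p (R z' x)"
      using c(2)[of z] elim by blast
    have "z' \<noteq> 0" using z' z by auto
    have b: "0 < ?b" by (rule lp_norm_resolvent_basis_pos[OF z])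
    have "ln c + real m * ln (cmod z) + ln ?b = ln (c * cmod z ^ m * ?b)"
      using c(1) z b by (simp add: ln_mult ln_realpow)
    also have "\<dots> \<le> ln (lp_norm p (R z' x))"
      using z'(2) c(1) z b by (intro ln_mono) auto
    finally have "(ln c + real m * ln (cmod z) + ln ?b) / ?M z \<le> ln (lp_norm p (R z' x)) / ?M z"
      using elim by (intro divide_right_mono) auto
    also have "?M z = ?M z'" using lp_opnorm_resolvent_cong[OF z'(1)[symmetric] z] by simp
    also have "ln (lp_norm p (R z' x)) / ?M z' < d"
      using \<delta>(2)[OF \<open>z' \<noteq> 0\<close>] z'(1) elim by simp
    finally have "?h z + ln ?b / ?M z < d"
      using lp_opnorm_resolvent_cong[OF z'(1)[symmetric] z] by (simp add: add_divide_distrib)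
    moreover have "r \<le> (1 + d) / 2" if "h + r < d" "- ((1 - d) / 2) < h" for h r :: real
      using that by (simp add: field_simps)
    ultimately show ?case using elim(1) by (simp only: ereal_less_eq)
  qed
  then have "local_power p T (basis_seq 0) \<le> ereal ((1 + d) / 2)"
    unfolding local_power_def by (rule Limsup_bounded)
  then show False using e0 d(2) by (simp add: one_ereal_def)
qed

end

theorem theorem2p4:
  fixes p :: real and T :: seq_op and w :: "nat \<Rightarrow> complex"
  assumes "1 \<le> p"
    and "forward_weighted_shift p T w"
    and "\<forall>n. w n \<noteq> 0"
    and "quasinilpotent p T"
    and "local_power p T (basis_seq 0) = 1"
  shows "power_set p T = {1}"
proof -
  interpret quasinilpotent_shift p T w
    using assms by unfold_locales auto
  have "local_power p T x = 1" if "x \<in> lp p" "x \<noteq> (\<lambda>n. 0)" for x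
    using local_power_le_1[OF that] local_power_ge_1[OF that assms(5)] by (rule antisym)
  then show ?thesis
    unfolding power_set_def using basis_seq_in_lp[of 0 p] basis_seq_nonzero[of 0] by force
qed

end
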